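(* Let $\mathcal H$ be a real Hilbert space, $p\ge1$, $\mathcal J:\mathcal H\to\mathbb R\cup\{+\infty\}$ absolutely $p$-homogeneous, proper, convex and lower semicontinuous, and let $u$ be the gradient flow of $\mathcal J$ with initial datum $f\in\overline{\mathrm{dom}(\mathcal J)}$, limit $u_\infty$ and extinction time $T_{\mathrm{ex}}>0$. Set $\Lambda(t):=\frac{p\mathcal J(u(t))}{\|u(t)-u_\infty\|^p}$ for $t<T_{\mathrm{ex}}$. Then for all $0<\delta<T_{\mathrm{ex}}$ and all $t\ge\delta$: $$\|u(t)-u_\infty\|^{2-p}\ge\|u(\delta)-u_\infty\|^{2-p}-(2-p)\Lambda(\delta)(t-\delta)\quad\text{if }p<2,$$ $$\|u(t)-u_\infty\|^{2}\ge\|u(\delta)-u_\infty\|^{2}\exp\left(-2\Lambda(\delta)(t-\delta)\right)\quad\text{if }p=2,$$ $$\|u(t)-u_\infty\|^{p-2}\ge\frac{1}{\|u(\delta)-u_\infty\|^{2-p}+(p-2)\Lambda(\delta)(t-\delta)}\quad\text{if }p>2,$$ and $\delta=0$ is admissible if $\mathcal J(f)<\infty$.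
   Context: $\mathcal J$ is absolutely $p$-homogeneous if $\mathcal J(0)=0$ and $\mathcal J(cu)=|c|^p\mathcal J(u)$ for $c\ne0$; $\mathrm{dom}(\mathcal J)=\{\mathcal J<\infty\}$; $\partial\mathcal J$ is the convex subdifferential. The null space $\mathcal N_{\mathcal J}=\{\mathcal J=0\}$ is a closed linear subspace. The gradient flow with initial datum $f\in\overline{\mathrm{dom}(\mathcal J)}$ is the unique continuous map $u:[0,\infty)\to\mathcal H$ with $u(0)=f$, Lipschitz on $[\delta,\infty)$ for all $\delta>0$, right-differentiable on $(0,\infty)$, with $-\partial_t^+u(t)$ equal to the minimal-norm element of $\partial\mathcal J(u(t))$ for all $t>0$. The limit $u_\infty:=\lim_{t\to\infty}u(t)$ exists and equals the orthogonal projection of $f$ onto $\mathcal N_{\mathcal J}$. The extinction time is $T_{\mathrm{ex}}:=\inf\{t>0:u(t)=u_\infty\}\in[0,\infty]$ with $\inf\emptyset=\infty$. *)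

theory Defs
  imports "HOL-Analysis.Analysis"
begin

text \<open>
  Functionals with values in the reals extended by \<open>+\<infinity>\<close> are rendered as \<open>ereal\<close>-valued functions;
  the exclusion of the value \<open>-\<infinity>\<close> is part of \<open>proper_fun\<close>.  A real Hilbert space is a type of
  sort \<open>{real_inner, complete_space}\<close>.
\<close>

definition proper_fun :: "('a \<Rightarrow> ereal) \<Rightarrow> bool" where
  "proper_fun J \<longleftrightarrow> (\<forall>x. J x \<noteq> -\<infinity>) \<and> (\<exists>x. J x < \<infinity>)"

definition effective_domain :: "('a \<Rightarrow> ereal) \<Rightarrow> 'a set" where
  "effective_domain J = {x. J x < \<infinity>}"

text \<open>The library's \<open>convex_on\<close> does not cover \<open>ereal\<close>-valued functions.
  Here \<open>0 * \<infinity> = 0\<close> in \<open>ereal\<close>, so the endpoints \<open>s = 0, 1\<close> impose no condition.\<close>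

definition convex_fun :: "('a::real_vector \<Rightarrow> ereal) \<Rightarrow> bool" where
  "convex_fun J \<longleftrightarrow> (\<forall>x y s. 0 \<le> s \<and> s \<le> 1 \<longrightarrow>
     J ((1 - s) *\<^sub>R x + s *\<^sub>R y) \<le> ereal (1 - s) * J x + ereal s * J y)"

definition lsc_fun :: "('a::topological_space \<Rightarrow> ereal) \<Rightarrow> bool" where
  "lsc_fun J \<longleftrightarrow> (\<forall>x. J x \<le> Liminf (at x) J)"

definition abs_homogeneous :: "real \<Rightarrow> ('a::real_vector \<Rightarrow> ereal) \<Rightarrow> bool" where
  "abs_homogeneous p J \<longleftrightarrow>
     J 0 = 0 \<and> (\<forall>c u. c \<noteq> 0 \<longrightarrow> J (c *\<^sub>R u) = ereal (\<bar>c\<bar> powr p) * J u)"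

text \<open>For proper \<open>J\<close> this is empty at every point where \<open>J u = \<infinity>\<close>.\<close>

definition subdifferential :: "('a::real_inner \<Rightarrow> ereal) \<Rightarrow> 'a \<Rightarrow> 'a set" where
  "subdifferential J u = {\<zeta>. \<forall>v. J u + ereal (\<zeta> \<bullet> (v - u)) \<le> J v}"

text \<open>Curves \<open>[0,\<infinity>) \<rightarrow> H\<close> are functions on \<open>real\<close> whose values at negative times play no role.
  A derivative along \<open>at_right t\<close> is the one-sided limit of the difference quotients from the right.\<close>

definition gradient_flow ::
    "('a::real_inner \<Rightarrow> ereal) \<Rightarrow> 'a \<Rightarrow> (real \<Rightarrow> 'a) \<Rightarrow> bool" where
  "gradient_flow J f u \<longleftrightarrow>
     continuous_on {0..} u \<and> u 0 = f \<and>
     (\<forall>\<delta>>0. \<exists>L. L-lipschitz_on {\<delta>..} u) \<and>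
     (\<forall>t>0. \<exists>\<zeta>. is_arg_min norm (\<lambda>\<eta>. \<eta> \<in> subdifferential J (u t)) \<zeta> \<and>
              (u has_vector_derivative - \<zeta>) (at_right t))"

definition flow_limit :: "(real \<Rightarrow> 'a::real_normed_vector) \<Rightarrow> 'a" where
  "flow_limit u = Lim at_top u"

definition extinction_time :: "(real \<Rightarrow> 'a::real_normed_vector) \<Rightarrow> ereal" where
  "extinction_time u = Inf {ereal t | t. 0 < t \<and> u t = flow_limit u}"

text \<open>\<open>J (u t)\<close> is finite for every \<open>t > 0\<close> because the subdifferential at \<open>u t\<close> is nonempty, so
  \<open>real_of_ereal\<close> only matters for \<open>t = 0\<close>, and there only if \<open>J (u 0) = \<infinity>\<close>.\<close>

definition rayleigh_quotient ::
    "real \<Rightarrow> ('a::real_normed_vector \<Rightarrow> ereal) \<Rightarrow> (real \<Rightarrow> 'a) \<Rightarrow> real \<Rightarrow> real" where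
  "rayleigh_quotient p J u t =
     p * real_of_ereal (J (u t)) / norm (u t - flow_limit u) powr p"

end

theory Submission
  imports Defs
begin

text \<open>
  Write \<open>N t = norm (u t - u\<^sub>\<infinity>)\<close>, and let \<open>z t\<close> be the minimal-norm subgradient at \<open>u t\<close>, so that
  the right derivative of \<open>u\<close> is \<open>-z\<close>.  Euler's identity \<open>\<langle>z, u\<rangle> = p J(u)\<close> and the orthogonality of
  subgradients to the null space of \<open>J\<close> show that \<open>N\<^sup>2\<close> has right derivative \<open>-2 p J(u)\<close>.  Hence, as
  long as \<open>N > 0\<close>, the function \<open>N powr (2 - p) / (2 - p)\<close>, or \<open>ln N\<close> if \<open>p = 2\<close>, has right
  derivative \<open>-\<Lambda>\<close>.  All three bounds are integrated forms of the one inequality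
  \<open>\<Lambda> t \<le> \<Lambda> \<delta>\<close> for \<open>\<delta> \<le> t\<close>.

  The quotient \<open>\<Lambda>\<close> decreases because \<open>J(u)\<close> has right derivative \<open>-norm z ^ 2\<close> and, by Cauchy-Schwarz,
  \<open>p J(u) = \<langle>z, u - u\<^sub>\<infinity>\<rangle> \<le> norm z * N\<close> (\<open>rayleigh_antimono\<close>).  The delicate point is the energy
  dissipation identity \<open>energy_deriv\<close>: the subgradient inequality bounds the difference quotient
  of \<open>J(u)\<close> at \<open>t\<close> through \<open>z\<close> at the later time, so \<open>z\<close> has to be right-continuous.
  This holds because \<open>norm z\<close> decreases (the flow is a contraction) while \<open>z s\<close> for \<open>s\<close> slightly
  larger than \<open>t\<close> is an \<open>\<epsilon>\<close>-subgradient at \<open>u t\<close>, and \<open>\<epsilon>\<close>-subgradients of norm at most \<open>norm (z t)\<close>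
  are close to \<open>z t\<close> by uniform convexity (\<open>nested_convex_min_norm\<close>).

  That \<open>u\<close> converges, and that its limit lies in the null space, is derived from evenness of \<open>J\<close>:
  comparing with the reflected point \<open>- u t\<close> bounds \<open>norm (u s - u t) ^ 2 / 2\<close> by the decrease of
  \<open>norm u ^ 2\<close> between \<open>s\<close> and \<open>t\<close>.  After extinction \<open>N\<close> vanishes; the bound for \<open>p < 2\<close> then follows
  by continuity at the extinction time, and for \<open>p \<ge> 2\<close> the bound itself, applied just before that
  time, excludes extinction.
\<close>

section \<open>One-sided derivatives and minimal-norm elements\<close>

text \<open>
  For a flow that is only right-differentiable this replaces the mean value theorem.  For \<open>e > 0\<close> and
  \<open>a < c < b\<close>, consider the last point of \<open>{c..b}\<close> at which \<open>F\<close> is below the line of slope \<open>e\<close> through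
  \<open>(c, F c)\<close>: the right derivative there would produce a later one, unless the point is \<open>b\<close>.
  Continuity alone handles the passage \<open>c \<rightarrow> a\<close>, so that \<open>a\<close> may be the initial time \<open>0\<close> of a flow.
\<close>

lemma right_derivative_nonpos_imp_le:
  fixes F :: "real \<Rightarrow> real"
  assumes ab: "a \<le> b" and cont: "continuous_on {a..b} F"
    and deriv: "\<And>x. a < x \<Longrightarrow> x < b \<Longrightarrow> \<exists>d\<le>0. (F has_real_derivative d) (at_right x)"
  shows "F b \<le> F a"
proof -
  have slope: "F b \<le> F c + e * (b - c)" if c: "a < c" "c < b" and e: "e > 0" for c e
  proof (rule ccontr)
    assume neg: "\<not> ?thesis"
    define S where "S = {x \<in> {c..b}. F x - e * (x - c) \<le> F c}"
    have "continuous_on {c..b} F" using cont c by (auto intro: continuous_on_subset)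
    then have "closed S" unfolding S_def
      by (intro continuous_on_closed_Collect_le continuous_intros) auto
    moreover have "c \<in> S" using c by (simp add: S_def)
    moreover have bdd: "bdd_above S" by (rule bdd_aboveI[of _ b]) (auto simp: S_def)
    ultimately have m: "Sup S \<in> S" by (intro closed_contains_Sup) auto
    define m where "m = Sup S"
    have mS: "m \<in> S" using m by (simp add: m_def)
    then have "m \<noteq> b" using neg by (auto simp: S_def)
    with mS have mb: "c \<le> m" "m < b" by (auto simp: S_def)
    then obtain d where d: "d \<le> 0" "(F has_real_derivative d) (at_right m)"
      using deriv[of m] c by auto
    have "((\<lambda>y. (F y - F m) / (y - m)) \<longlongrightarrow> d) (at_right m)"
      using d(2) by (simp add: has_field_derivative_iff)
    then have "\<forall>\<^sub>F y in at_right m. (F y - F m) / (y - m) < e"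
      by (rule order_tendstoD) (use d(1) e in linarith)
    moreover have "\<forall>\<^sub>F y in at_right m. y \<in> {m<..<b}"
      using mb by (intro eventually_at_right_real) auto
    ultimately have "\<forall>\<^sub>F y in at_right m. y \<in> {m<..<b} \<and> (F y - F m) / (y - m) < e"
      by eventually_elim auto
    then obtain y where y: "y \<in> {m<..<b}" "(F y - F m) / (y - m) < e"
      using eventually_happens'[OF trivial_limit_at_right_real] by blast
    then have "F y - F m < e * (y - m)" by (simp add: field_simps)
    then have "y \<in> S" using mS y mb by (auto simp: S_def algebra_simps)
    then have "y \<le> m" unfolding m_def by (intro cSup_upper bdd)
    then show False using y by simp
  qed
  have ac: "F b \<le> F c" if c: "a < c" "c < b" for c
  proof (rule field_le_epsilon)
    fix e :: real assume "e > 0"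
    then show "F b \<le> F c + e" using slope[OF c, of "e / (b - c)"] c by simp
  qed
  show ?thesis
  proof (cases "a = b")
    case False
    then have ab': "a < b" using ab by simp
    have "(F \<longlongrightarrow> F a) (at_right a)"
      using cont ab' by (simp add: continuous_on_Icc_at_rightD)
    moreover have "\<forall>\<^sub>F c in at_right a. F b \<le> F c"
      using eventually_at_right_real[OF ab'] by eventually_elim (auto intro: ac)
    ultimately show ?thesis by (intro tendsto_lowerbound[of F]) auto
  qed simp
qed

text \<open>
  Near-minimizers of the norm over the \<open>K n\<close> form a Cauchy
  sequence by the parallelogram identity, and their limit lies in the intersection.  So the minimal norms
  over \<open>K n\<close> increase to \<open>norm m\<close>, and the parallelogram identity once more confines the elements
  of \<open>K n\<close> of norm at most \<open>norm m\<close> to a small neighbourhood of \<open>m\<close>.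
\<close>

lemma nested_convex_min_norm:
  fixes K :: "nat \<Rightarrow> 'a::{real_inner, complete_space} set"
  assumes closed: "\<And>n. closed (K n)" and convex: "\<And>n. convex (K n)" and dec: "decseq K"
    and m: "m \<in> (\<Inter>n. K n)" and min: "\<And>c. c \<in> (\<Inter>n. K n) \<Longrightarrow> norm m \<le> norm c"
    and e: "e > 0"
  shows "\<exists>n. \<forall>c\<in>K n. norm c \<le> norm m \<longrightarrow> norm (c - m) < e"
proof -
  define \<mu> where "\<mu> n = (INF c\<in>K n. (norm c)\<^sup>2)" for n
  have ne: "K n \<noteq> {}" for n using m by auto
  have bdd: "bdd_below ((\<lambda>c. (norm c)\<^sup>2) ` K n)" for n
    by (rule bdd_belowI[of _ 0]) auto
  have \<mu>_le: "\<mu> n \<le> (norm c)\<^sup>2" if "c \<in> K n" for n c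
    unfolding \<mu>_def by (rule cINF_lower[OF bdd that])
  have sub: "K k \<subseteq> K n" if "n \<le> k" for n k using dec that by (auto simp: decseq_def)
  have inc: "incseq \<mu>"
    unfolding incseq_def \<mu>_def by (intro allI impI cINF_superset_mono ne bdd sub) auto
  have "\<exists>c\<in>K n. (norm c)\<^sup>2 < \<mu> n + 1 / Suc n" for n
    using cINF_less_iff[OF ne bdd, of n "\<mu> n + 1 / Suc n"] by (simp add: \<mu>_def)
  then obtain c where c: "\<And>n. c n \<in> K n" "\<And>n. (norm (c n))\<^sup>2 < \<mu> n + 1 / Suc n" by metis
  have para: "(norm (x - y))\<^sup>2 \<le> 2 * (norm x)\<^sup>2 + 2 * (norm y)\<^sup>2 - 4 * \<mu> n"
    if "x \<in> K n" "y \<in> K n" for x y n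
  proof -
    have "(1/2) *\<^sub>R x + (1/2) *\<^sub>R y \<in> K n"
      using convexD[OF convex that, of "1/2" "1/2"] by simp
    from \<mu>_le[OF this] have "\<mu> n \<le> (norm ((1/2) *\<^sub>R (x + y)))\<^sup>2" by (simp add: scaleR_add_right)
    then have "4 * \<mu> n \<le> (norm (x + y))\<^sup>2" by (simp add: power_divide)
    then show ?thesis
      by (simp add: power2_norm_eq_inner inner_simps inner_commute)
  qed
  have \<mu>_m: "\<mu> n \<le> (norm m)\<^sup>2" for n using \<mu>_le[of m n] m by auto
  obtain l where l: "\<mu> \<longlonglongrightarrow> l" "\<And>n. \<mu> n \<le> l"
    using incseq_convergent[OF inc, of "(norm m)\<^sup>2"] \<mu>_m by blast
  have bound: "(norm (c k - c n))\<^sup>2 \<le> 2 * (l - \<mu> n) + 4 / Suc n" if "n \<le> k" for n k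
  proof -
    have "1 / Suc k \<le> 1 / real (Suc n)" using that by (intro divide_left_mono) auto
    then show ?thesis
      using para[of "c k" n "c n"] c(1)[of k] c(1)[of n] sub[OF that] c(2)[of k] c(2)[of n] l(2)[of k]
      by auto
  qed
  have lim0: "(\<lambda>n. 2 * (l - \<mu> n) + 4 / Suc n) \<longlonglongrightarrow> 2 * (l - l) + 0"
    by (intro tendsto_intros l(1) LIMSEQ_Suc[OF lim_const_over_n])
  have "Cauchy c"
  proof (rule metric_CauchyI)
    fix r :: real assume r: "r > 0"
    have "\<forall>\<^sub>F n in sequentially. 2 * (l - \<mu> n) + 4 / Suc n < (r/2)\<^sup>2"
      using lim0 r by (intro order_tendstoD) auto
    then obtain n where n: "2 * (l - \<mu> n) + 4 / Suc n < (r/2)\<^sup>2"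
      using eventually_happens'[OF sequentially_bot] by blast
    have "dist (c k) (c n) < r/2" if "n \<le> k" for k
      using bound[OF that] n r by (intro power2_less_imp_less[of _ "r/2"]) (auto simp: dist_norm)
    then have "dist (c k) (c j) < r" if "n \<le> k" "n \<le> j" for k j
      using that dist_triangle_half_l by blast
    then show "\<exists>M. \<forall>k\<ge>M. \<forall>j\<ge>M. dist (c k) (c j) < r" by blast
  qed
  then obtain x where x: "c \<longlonglongrightarrow> x" by (auto simp: Cauchy_convergent_iff convergent_def)
  have "x \<in> K n" for n
  proof (rule Lim_in_closed_set[OF closed _ _ x])
    show "\<forall>\<^sub>F k in sequentially. c k \<in> K n"
      using eventually_ge_at_top[of n] by eventually_elim (use sub c(1) in blast)
  qed simp
  then have mx: "norm m \<le> norm x" by (intro min) auto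
  have "(norm x)\<^sup>2 \<le> l + 0"
  proof (rule LIMSEQ_le)
    show "(\<lambda>n. (norm (c n))\<^sup>2) \<longlonglongrightarrow> (norm x)\<^sup>2" by (intro tendsto_intros x)
    show "(\<lambda>n. \<mu> n + 1 / Suc n) \<longlonglongrightarrow> l + 0"
      by (intro tendsto_intros l(1) LIMSEQ_Suc[OF lim_const_over_n])
  qed (use c(2) less_imp_le in blast)
  then have "(norm m)\<^sup>2 \<le> l" using mx by (smt (verit) norm_ge_zero power_mono)
  then have "\<forall>\<^sub>F n in sequentially. \<mu> n > (norm m)\<^sup>2 - e\<^sup>2 / 4"
    using e by (intro order_tendstoD[OF l(1)]) (smt (verit) divide_pos_pos zero_less_power)
  then obtain n where n: "\<mu> n > (norm m)\<^sup>2 - e\<^sup>2 / 4"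
    using eventually_happens'[OF sequentially_bot] by blast
  have "norm (c - m) < e" if "c \<in> K n" "norm c \<le> norm m" for c
  proof -
    have "(norm c)\<^sup>2 \<le> (norm m)\<^sup>2" using that by (intro power_mono) auto
    moreover have "(norm (c - m))\<^sup>2 \<le> 2 * (norm c)\<^sup>2 + 2 * (norm m)\<^sup>2 - 4 * \<mu> n"
      using m by (intro para that(1)) auto
    ultimately have "(norm (c - m))\<^sup>2 < e\<^sup>2" using n by linarith
    then show ?thesis by (rule power2_less_imp_less) (use e in simp)
  qed
  then show ?thesis by blast
qed

section \<open>Energy dissipation along a subgradient flow\<close>

text \<open>
  The selection \<open>z\<close> is the minimal section of the subdifferential along the curve; it exists
  at every positive time, which forces the energy to be finite there.
\<close>

locale subgradient_flow =
  fixes J :: "'a::{real_inner, complete_space} \<Rightarrow> ereal"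
    and u :: "real \<Rightarrow> 'a" and z :: "real \<Rightarrow> 'a"
  assumes proper: "proper_fun J"
    and cont: "continuous_on {0..} u"
    and subgrad: "t > 0 \<Longrightarrow> z t \<in> subdifferential J (u t)"
    and least: "t > 0 \<Longrightarrow> \<eta> \<in> subdifferential J (u t) \<Longrightarrow> norm (z t) \<le> norm \<eta>"
    and deriv: "t > 0 \<Longrightarrow> (u has_vector_derivative - z t) (at_right t)"
begin

definition energy :: "real \<Rightarrow> real" where
  "energy t = real_of_ereal (J (u t))"

lemma not_MInf: "J v \<noteq> -\<infinity>" using proper by (simp add: proper_fun_def)

lemma J_eq_energy:
  assumes "t > 0" shows "J (u t) = ereal (energy t)"
proof -
  obtain v where v: "J v < \<infinity>" using proper by (auto simp: proper_fun_def)
  have "J (u t) + ereal (z t \<bullet> (v - u t)) \<le> J v"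
    using subgrad[OF assms] by (simp add: subdifferential_def)
  then have "J (u t) \<noteq> \<infinity>" using v by auto
  then show ?thesis using not_MInf[of "u t"] by (cases "J (u t)") (auto simp: energy_def)
qed

lemma subgrad_ineq:
  assumes "t > 0" "J v = ereal r"
  shows "energy t + z t \<bullet> (v - u t) \<le> r"
proof -
  have "J (u t) + ereal (z t \<bullet> (v - u t)) \<le> J v"
    using subgrad[OF assms(1)] by (simp add: subdifferential_def)
  then show ?thesis using assms by (simp add: J_eq_energy)
qed

lemma subgrad_energy: "t > 0 \<Longrightarrow> s > 0 \<Longrightarrow> energy t + z t \<bullet> (u s - u t) \<le> energy s"
  by (rule subgrad_ineq) (auto simp: J_eq_energy)

lemma tendsto_u: "t > 0 \<Longrightarrow> (u \<longlongrightarrow> u t) (at_right t)"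
  using cont continuous_on_subset[OF cont, of "{t..t+1}"]
  by (intro continuous_on_Icc_at_rightD[of t "t+1"]) auto

lemma dist_sq_deriv:
  assumes "t > 0"
  shows "((\<lambda>x. (norm (u x - w))\<^sup>2) has_real_derivative - 2 * (z t \<bullet> (u t - w))) (at_right t)"
proof -
  note [derivative_intros] = deriv[OF assms, unfolded has_vector_derivative_def]
  show ?thesis unfolding power2_norm_eq_inner has_field_derivative_def
    by (rule derivative_eq_intros refl | simp add: inner_commute algebra_simps fun_eq_iff)+
qed

lemma cont_dist: "continuous_on {0..} (\<lambda>x. norm (u x - w))"
  by (intro continuous_intros cont)

text \<open>
  A time shift of the flow is again a flow, and two flows approach each other since the
  subdifferential is monotone.
\<close>

lemma difference_contraction:
  assumes "0 < s" "s \<le> t" "0 < h"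
  shows "norm (u (t + h) - u t) \<le> norm (u (s + h) - u s)"
proof -
  have "(norm (u (t + h) - u t))\<^sup>2 \<le> (norm (u (s + h) - u s))\<^sup>2"
  proof (rule right_derivative_nonpos_imp_le[where F="\<lambda>x. (norm (u (x + h) - u x))\<^sup>2", OF assms(2)])
    have "continuous_on {s..t} (\<lambda>x. u (x + h))"
      using assms by (intro continuous_on_compose2[OF cont] continuous_intros) auto
    moreover have "continuous_on {s..t} u"
      using assms by (intro continuous_on_subset[OF cont]) auto
    ultimately show "continuous_on {s..t} (\<lambda>x. (norm (u (x + h) - u x))\<^sup>2)"
      by (intro continuous_intros)
    fix x assume "s < x" "x < t"
    then have x: "x > 0" "x + h > 0" using assms by auto
    \<comment> \<open>The chain rule differentiates along the image of the right half-line at \<open>x\<close>.\<close>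
    have img: "(\<lambda>y. y + h) ` {x<..} = {x + h<..}"
    proof (rule equalityI)
      show "{x + h<..} \<subseteq> (\<lambda>y. y + h) ` {x<..}"
      proof
        fix y assume "y \<in> {x + h<..}"
        then show "y \<in> (\<lambda>y. y + h) ` {x<..}" by (intro image_eqI[of _ _ "y - h"]) auto
      qed
    qed auto
    have "((\<lambda>y. y + h) has_vector_derivative 1) (at_right x)"
      by (auto intro!: derivative_eq_intros)
    from vector_diff_chain_within[OF this, of u "- z (x + h)"] deriv[OF x(2)]
    have d: "((\<lambda>y. u (y + h)) has_vector_derivative - z (x + h)) (at_right x)"
      by (simp add: img o_def)
    note [derivative_intros] = deriv[OF x(1), unfolded has_vector_derivative_def]
      d[unfolded has_vector_derivative_def]
    have "((\<lambda>x. (norm (u (x + h) - u x))\<^sup>2) has_real_derivative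
        - 2 * ((z (x + h) - z x) \<bullet> (u (x + h) - u x))) (at_right x)"
      unfolding power2_norm_eq_inner has_field_derivative_def
      by (rule derivative_eq_intros refl | simp add: inner_commute algebra_simps fun_eq_iff)+
    moreover have "0 \<le> (z (x + h) - z x) \<bullet> (u (x + h) - u x)"
      using subgrad_energy[OF x(1) x(2)] subgrad_energy[OF x(2) x(1)]
      by (simp add: inner_simps)
    ultimately show "\<exists>d\<le>0. ((\<lambda>x. (norm (u (x + h) - u x))\<^sup>2) has_real_derivative d) (at_right x)"
      by (intro exI[of _ "- 2 * ((z (x + h) - z x) \<bullet> (u (x + h) - u x))"]) simp
  qed
  then show ?thesis by (rule power2_le_imp_le) simp
qed

lemma difference_quotient:
  assumes "t > 0"
  shows "((\<lambda>y. (u y - u t) /\<^sub>R (y - t)) \<longlongrightarrow> - z t) (at_right t)"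
proof -
  have "((\<lambda>y. ((u y - u t) - (y - t) *\<^sub>R (- z t)) /\<^sub>R norm (y - t)) \<longlongrightarrow> 0) (at_right t)"
    using deriv[OF assms] unfolding has_vector_derivative_def has_derivative_at_within by blast
  then have "((\<lambda>y. (u y - u t) /\<^sub>R (y - t) - - z t) \<longlongrightarrow> 0) (at_right t)"
  proof (rule Lim_transform_eventually)
    show "\<forall>\<^sub>F y in at_right t. ((u y - u t) - (y - t) *\<^sub>R (- z t)) /\<^sub>R norm (y - t)
        = (u y - u t) /\<^sub>R (y - t) - - z t"
      using eventually_at_right_less[of t] by eventually_elim (simp add: scaleR_add_right)
  qed
  then show ?thesis by (rule LIM_zero_cancel)
qed

text \<open>The contraction property passes to the limit \<open>h \<rightarrow> 0\<close> of the difference quotients.\<close>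

lemma norm_z_antimono:
  assumes "0 < s" "s \<le> t"
  shows "norm (z t) \<le> norm (z s)"
proof -
  have lim: "((\<lambda>h. norm ((u (r + h) - u r) /\<^sub>R h)) \<longlongrightarrow> norm (z r)) (at_right 0)" if "r > 0" for r
  proof -
    have "((\<lambda>h. norm ((u (r + h) - u r) /\<^sub>R h)) \<longlongrightarrow> norm (- z r)) (at_right 0)"
      using difference_quotient[OF that]
      by (intro tendsto_norm) (simp add: filterlim_at_right_to_0[of _ _ r] add.commute)
    then show ?thesis by simp
  qed
  show ?thesis
  proof (rule tendsto_le[OF _ lim lim])
    show "\<forall>\<^sub>F h in at_right 0. norm ((u (t + h) - u t) /\<^sub>R h) \<le> norm ((u (s + h) - u s) /\<^sub>R h)"
      using eventually_at_right_less[of 0]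
      by eventually_elim (use difference_contraction assms in \<open>auto intro!: mult_left_mono\<close>)
  qed (use assms in auto)
qed

text \<open>
  Subgradients at both endpoints bound the difference from both sides, and on \<open>{a..}\<close> all of them
  have norm at most \<open>norm (z a)\<close>.
\<close>

lemma energy_diff_le:
  assumes "0 < a" "a \<le> s" "a \<le> t"
  shows "\<bar>energy s - energy t\<bar> \<le> norm (z a) * norm (u s - u t)"
proof -
  have one: "energy x - energy y \<le> norm (z a) * norm (u x - u y)" if "a \<le> x" "a \<le> y" for x y
  proof -
    have "energy x - energy y \<le> z x \<bullet> (u x - u y)"
      using subgrad_energy[of x y] assms that by (simp add: inner_simps)
    also have "\<dots> \<le> norm (z x) * norm (u x - u y)" by (rule norm_cauchy_schwarz)
    also have "\<dots> \<le> norm (z a) * norm (u x - u y)"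
      using assms that by (intro mult_right_mono norm_z_antimono) auto
    finally show ?thesis .
  qed
  show ?thesis using one[of s t] one[of t s] assms by (auto simp: norm_minus_commute abs_le_iff)
qed

lemma cont_energy:
  assumes "0 < a" shows "continuous_on {a..} energy"
  unfolding continuous_on_def
proof
  fix t assume t: "t \<in> {a..}"
  have "(u \<longlongrightarrow> u t) (at t within {a..})"
    using continuous_on_subset[OF cont, of "{a..}"] t assms by (auto simp: continuous_on_def)
  then have "((\<lambda>s. norm (z a) * norm (u s - u t)) \<longlongrightarrow> norm (z a) * norm (u t - u t)) (at t within {a..})"
    by (intro tendsto_intros)
  then have lim: "((\<lambda>s. norm (z a) * norm (u s - u t)) \<longlongrightarrow> 0) (at t within {a..})" by simp
  have "\<forall>\<^sub>F s in at t within {a..}. norm (energy s - energy t) \<le> norm (z a) * norm (u s - u t)"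
    unfolding eventually_at_filter using t assms by (auto intro!: always_eventually energy_diff_le)
  from Lim_null_comparison[OF this lim] show "(energy \<longlongrightarrow> energy t) (at t within {a..})"
    by (simp add: LIM_zero_iff)
qed

text \<open>
  For \<open>s > t\<close> close to \<open>t\<close>, the vector \<open>z s\<close> is an approximate subgradient at \<open>u t\<close> whose norm does
  not exceed that of the minimal one, so it has to be close to \<open>z t\<close>.
\<close>

lemma z_right_continuous:
  assumes t: "t > 0"
  shows "(z \<longlongrightarrow> z t) (at_right t)"
proof -
  \<comment> \<open>\<open>K n\<close> is the \<open>1 / (n + 1)\<close>-subdifferential at \<open>u t\<close>; the \<open>K n\<close> intersect in the subdifferential.\<close>
  define K where "K n = {c. \<forall>v. J v \<noteq> \<infinity> \<longrightarrow>
    energy t + c \<bullet> (v - u t) \<le> real_of_ereal (J v) + 1 / Suc n}" for n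
  have K_sub: "c \<in> subdifferential J (u t)" if c: "c \<in> (\<Inter>n. K n)" for c
    unfolding subdifferential_def
  proof clarify
    fix v
    show "J (u t) + ereal (c \<bullet> (v - u t)) \<le> J v"
    proof (cases "J v = \<infinity>")
      case False
      then obtain r where r: "J v = ereal r" using not_MInf[of v] by (cases "J v") auto
      have "energy t + c \<bullet> (v - u t) \<le> r + 0"
      proof (rule LIMSEQ_le_const)
        show "(\<lambda>n. r + 1 / real (Suc n)) \<longlonglongrightarrow> r + 0"
          by (intro tendsto_intros LIMSEQ_Suc[OF lim_const_over_n])
        show "\<exists>N. \<forall>n\<ge>N. energy t + c \<bullet> (v - u t) \<le> r + 1 / real (Suc n)"
        proof (intro exI allI impI)
          fix n
          have "c \<in> K n" using c by blast
          then have "energy t + c \<bullet> (v - u t) \<le> real_of_ereal (J v) + 1 / real (Suc n)"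
            unfolding K_def using False by blast
          then show "energy t + c \<bullet> (v - u t) \<le> r + 1 / real (Suc n)" using r by simp
        qed
      qed
      then show ?thesis using r t by (simp add: J_eq_energy)
    qed simp
  qed
  have z_K: "z t \<in> K n" for n
  proof -
    have "energy t + z t \<bullet> (v - u t) \<le> real_of_ereal (J v) + 1 / Suc n" if "J v \<noteq> \<infinity>" for v
    proof -
      have "energy t + z t \<bullet> (v - u t) \<le> real_of_ereal (J v)"
        using that not_MInf[of v] t by (intro subgrad_ineq) (auto simp: ereal_real)
      then show ?thesis by (smt (verit) divide_nonneg_nonneg of_nat_0_le_iff)
    qed
    then show ?thesis by (auto simp: K_def)
  qed
  have clK: "closed (K n)" for n
    unfolding K_def by (intro closed_Collect_all closed_Collect_imp closed_Collect_le continuous_intros) auto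
  have cvK: "convex (K n)" for n
  proof (rule convexI)
    fix x y a b assume xy: "x \<in> K n" "y \<in> K n" and ab: "0 \<le> a" "0 \<le> b" "a + b = (1::real)"
    have "energy t + (a *\<^sub>R x + b *\<^sub>R y) \<bullet> (v - u t) \<le> real_of_ereal (J v) + 1 / Suc n"
      if v: "J v \<noteq> \<infinity>" for v
    proof -
      let ?R = "real_of_ereal (J v) + 1 / Suc n"
      have "a * (energy t + x \<bullet> (v - u t)) + b * (energy t + y \<bullet> (v - u t)) \<le> a * ?R + b * ?R"
      proof (intro add_mono[OF mult_left_mono mult_left_mono])
        show "energy t + x \<bullet> (v - u t) \<le> ?R" "energy t + y \<bullet> (v - u t) \<le> ?R"
          using xy v unfolding K_def by blast+
      qed (use ab in auto)
      also have "\<dots> = (a + b) * ?R" by (simp only: distrib_right)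
      finally have "(a + b) * energy t + (a *\<^sub>R x + b *\<^sub>R y) \<bullet> (v - u t) \<le> (a + b) * ?R"
        by (simp add: inner_add_left algebra_simps)
      then show ?thesis using ab by simp
    qed
    then show "a *\<^sub>R x + b *\<^sub>R y \<in> K n" by (auto simp: K_def)
  qed
  have decK: "decseq K"
  proof (rule decseq_SucI)
    fix n
    have "1 / real (Suc (Suc n)) \<le> 1 / real (Suc n)" by (intro divide_left_mono) auto
    then show "K (Suc n) \<subseteq> K n" unfolding K_def by (smt (verit) Collect_mono_iff)
  qed
  have near: "\<forall>\<^sub>F s in at_right t. z s \<in> K n" for n
  proof -
    have "((\<lambda>s. 2 * (norm (z t) * norm (u s - u t))) \<longlongrightarrow> 2 * (norm (z t) * norm (u t - u t))) (at_right t)"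
      by (intro tendsto_intros tendsto_u t)
    then have "\<forall>\<^sub>F s in at_right t. 2 * (norm (z t) * norm (u s - u t)) < 1 / Suc n"
      by (rule order_tendstoD) auto
    moreover have "\<forall>\<^sub>F s in at_right t. t < s" by (rule eventually_at_right_less)
    ultimately show ?thesis
    proof eventually_elim
      case (elim s)
      have s: "s > 0" using elim t by simp
      have "energy t + z s \<bullet> (v - u t) \<le> real_of_ereal (J v) + 1 / Suc n" if "J v \<noteq> \<infinity>" for v
      proof -
        have "energy s + z s \<bullet> (v - u s) \<le> real_of_ereal (J v)"
          using that not_MInf[of v] s by (intro subgrad_ineq) (auto simp: ereal_real)
        moreover have "energy t - energy s \<le> norm (z t) * norm (u s - u t)"
          using energy_diff_le[of t s t] t elim by auto
        moreover have "z s \<bullet> (u s - u t) \<le> norm (z t) * norm (u s - u t)"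
        proof -
          have "z s \<bullet> (u s - u t) \<le> norm (z s) * norm (u s - u t)" by (rule norm_cauchy_schwarz)
          also have "\<dots> \<le> norm (z t) * norm (u s - u t)"
            using elim t by (intro mult_right_mono norm_z_antimono) auto
          finally show ?thesis .
        qed
        moreover have "z s \<bullet> (v - u t) = z s \<bullet> (v - u s) + z s \<bullet> (u s - u t)"
          by (simp add: inner_simps)
        ultimately show ?thesis using elim by linarith
      qed
      then show ?case by (auto simp: K_def)
    qed
  qed
  show ?thesis
  proof (rule tendstoI)
    fix e :: real assume "e > 0"
    then obtain n where n: "\<forall>c\<in>K n. norm c \<le> norm (z t) \<longrightarrow> norm (c - z t) < e"
      using nested_convex_min_norm[OF clK cvK decK, of "z t" e] z_K K_sub least[OF t] by blast
    show "\<forall>\<^sub>F s in at_right t. dist (z s) (z t) < e"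
      using near[of n] eventually_at_right_less[of t]
      by eventually_elim (use n t norm_z_antimono in \<open>auto simp: dist_norm\<close>)
  qed
qed

text \<open>
  The difference quotient of the energy lies between the inner products of that of \<open>u\<close> with \<open>z t\<close> and
  with \<open>z s\<close>; both tend to the same limit by right-continuity of \<open>z\<close>.
\<close>

lemma energy_deriv:
  assumes t: "t > 0"
  shows "(energy has_real_derivative - (norm (z t))\<^sup>2) (at_right t)"
  unfolding has_field_derivative_iff
proof (rule tendsto_sandwich)
  let ?q = "\<lambda>s. (u s - u t) /\<^sub>R (s - t)"
  have lim: "((\<lambda>s. w s \<bullet> ?q s) \<longlongrightarrow> - (norm (z t))\<^sup>2) (at_right t)"
    if "(w \<longlongrightarrow> z t) (at_right t)" for w
    using tendsto_inner[OF that difference_quotient[OF t]] by (simp add: power2_norm_eq_inner)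
  show "((\<lambda>s. z t \<bullet> ?q s) \<longlongrightarrow> - (norm (z t))\<^sup>2) (at_right t)" by (rule lim) simp
  show "((\<lambda>s. z s \<bullet> ?q s) \<longlongrightarrow> - (norm (z t))\<^sup>2) (at_right t)"
    by (rule lim) (rule z_right_continuous[OF t])
  show "\<forall>\<^sub>F s in at_right t. z t \<bullet> ?q s \<le> (energy s - energy t) / (s - t)"
    using eventually_at_right_less[of t]
  proof eventually_elim
    case (elim s)
    then show ?case using subgrad_energy[of t s] t by (simp add: divide_simps)
  qed
  show "\<forall>\<^sub>F s in at_right t. (energy s - energy t) / (s - t) \<le> z s \<bullet> ?q s"
    using eventually_at_right_less[of t]
  proof eventually_elim
    case (elim s)
    then show ?case using subgrad_energy[of s t] t by (simp add: divide_simps inner_simps)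
  qed
qed

lemma energy_antimono:
  assumes "0 < s" "s \<le> t"
  shows "energy t \<le> energy s"
proof (rule right_derivative_nonpos_imp_le[OF assms(2)])
  show "continuous_on {s..t} energy"
    using assms by (intro continuous_on_subset[OF cont_energy[of s]]) auto
  show "\<exists>d\<le>0. (energy has_real_derivative d) (at_right x)" if "s < x" "x < t" for x
    using energy_deriv[of x] that assms by (intro exI[of _ "- (norm (z x))\<^sup>2"]) auto
qed

text \<open>
  There is no subgradient at time \<open>0\<close> to compare with.  But if the energy exceeded \<open>J (u 0)\<close> by \<open>c > 0\<close>
  at time \<open>t\<close>, it would do so throughout \<open>(0, t]\<close>, and the subgradient inequality tested at
  \<open>u 0\<close> would force \<open>norm (u x - u 0) ^ 2\<close> to decrease strictly from the value \<open>0\<close>.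
\<close>

lemma energy_le_initial:
  assumes fin: "J (u 0) = ereal r" and t: "0 < t"
  shows "energy t \<le> r"
proof (rule ccontr)
  assume neg: "\<not> ?thesis"
  define c where "c = energy t - r"
  have c: "c > 0" using neg by (simp add: c_def)
  have "(norm (u t - u 0))\<^sup>2 + 2 * c * t \<le> (norm (u 0 - u 0))\<^sup>2 + 2 * c * 0"
  proof (rule right_derivative_nonpos_imp_le[where F="\<lambda>x. (norm (u x - u 0))\<^sup>2 + 2 * c * x"])
    have "continuous_on {0..t} u" by (rule continuous_on_subset[OF cont]) auto
    then show "continuous_on {0..t} (\<lambda>x. (norm (u x - u 0))\<^sup>2 + 2 * c * x)"
      by (intro continuous_intros)
    fix x assume x: "0 < x" "x < t"
    have "((\<lambda>x. (norm (u x - u 0))\<^sup>2 + 2 * c * x) has_real_derivative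
       - 2 * (z x \<bullet> (u x - u 0)) + 2 * c) (at_right x)"
      using DERIV_add[OF dist_sq_deriv[OF x(1), of "u 0"] DERIV_cmult[OF DERIV_ident, of "2 * c"]] by simp
    moreover have "energy x + z x \<bullet> (u 0 - u x) \<le> r" by (rule subgrad_ineq) (use x fin in auto)
    moreover have "energy t \<le> energy x" using energy_antimono x by simp
    ultimately show "\<exists>d\<le>0. ((\<lambda>x. (norm (u x - u 0))\<^sup>2 + 2 * c * x) has_real_derivative d) (at_right x)"
      by (intro exI[of _ "- 2 * (z x \<bullet> (u x - u 0)) + 2 * c"]) (auto simp: c_def inner_simps)
  qed (use t in auto)
  moreover have "0 < 2 * c * t" using c t by simp
  moreover have "0 \<le> (norm (u t - u 0))\<^sup>2" by simp
  ultimately show False by simp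
qed

end

section \<open>Convergence of homogeneous flows\<close>

locale homogeneous_flow = subgradient_flow J u z
  for J :: "'a::{real_inner, complete_space} \<Rightarrow> ereal" and u z +
  fixes p :: real
  assumes p_ge_1: "p \<ge> 1"
    and homogeneous: "abs_homogeneous p J"
    and convex: "convex_fun J"
    and lsc: "lsc_fun J"
begin

lemma J_zero: "J 0 = 0" using homogeneous by (simp add: abs_homogeneous_def)

lemma J_scaleR: "c \<noteq> 0 \<Longrightarrow> J (c *\<^sub>R v) = ereal (\<bar>c\<bar> powr p) * J v"
  using homogeneous by (simp add: abs_homogeneous_def)

lemma J_uminus: "J (- v) = J v"
  using J_scaleR[of "-1" v] by (simp add: one_ereal_def[symmetric])

text \<open>By evenness, \<open>J 0 = 0\<close> is at most the mean of \<open>J v\<close> and \<open>J (- v)\<close>, which is \<open>J v\<close>.\<close>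

lemma J_nonneg: "0 \<le> J v"
proof -
  have "J ((1 - 1/2) *\<^sub>R v + (1/2) *\<^sub>R (- v)) \<le> ereal (1 - 1/2) * J v + ereal (1/2) * J (- v)"
    by (rule convex[unfolded convex_fun_def, rule_format]) simp
  moreover have "(1 - 1/2) *\<^sub>R v + (1/2) *\<^sub>R (- v) = 0" by simp
  ultimately have "0 \<le> ereal (1/2) * J v + ereal (1/2) * J v" by (simp add: J_uminus J_zero)
  then show ?thesis using not_MInf[of v] by (cases "J v") auto
qed

lemma energy_nonneg: "0 \<le> energy t"
  unfolding energy_def by (intro real_of_ereal_pos J_nonneg)

text \<open>
  The subgradient inequality along the ray through \<open>u t\<close> says that \<open>F\<close> is minimal at \<open>c = 1\<close>; the
  identity is the vanishing of its derivative there.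
\<close>

lemma euler_identity:
  assumes t: "t > 0"
  shows "z t \<bullet> u t = p * energy t"
proof -
  define F where "F c = c powr p * energy t - energy t - (c - 1) * (z t \<bullet> u t)" for c
  have "(F has_real_derivative p * energy t - z t \<bullet> u t) (at 1)"
    unfolding F_def by (auto intro!: derivative_eq_intros)
  moreover have "F 1 \<le> F c" if "\<bar>1 - c\<bar> < 1" for c
  proof -
    have c: "c > 0" using that by auto
    have "energy t + z t \<bullet> (c *\<^sub>R u t - u t) \<le> c powr p * energy t"
      using c t by (intro subgrad_ineq) (auto simp: J_scaleR J_eq_energy)
    then show ?thesis by (simp add: F_def inner_simps algebra_simps)
  qed
  ultimately have "p * energy t - z t \<bullet> u t = 0"
    by (intro DERIV_local_min[of F _ 1 1]) auto
  then show ?thesis by simp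
qed

text \<open>
  \<open>J\<close> vanishes on the whole line through \<open>w\<close>, so a subgradient is bounded above along that line.
\<close>

lemma null_orthogonal:
  assumes w: "J w = 0" and t: "t > 0"
  shows "z t \<bullet> w = 0"
proof (rule ccontr)
  assume nz: "z t \<bullet> w \<noteq> 0"
  define c where "c = (z t \<bullet> u t - energy t + 1) / (z t \<bullet> w)"
  have "J (c *\<^sub>R w) = ereal 0"
    using J_scaleR[of c w] J_zero w by (cases "c = 0") (auto simp: zero_ereal_def)
  then have "energy t + z t \<bullet> (c *\<^sub>R w - u t) \<le> 0" using t by (intro subgrad_ineq)
  then have "c * (z t \<bullet> w) \<le> z t \<bullet> u t - energy t" by (simp add: inner_simps)
  then show False using nz by (simp add: c_def)
qed

lemma dist_null_deriv:
  assumes "J w = 0" "t > 0"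
  shows "((\<lambda>x. (norm (u x - w))\<^sup>2) has_real_derivative - 2 * (p * energy t)) (at_right t)"
  using dist_sq_deriv[OF assms(2), of w] null_orthogonal[OF assms] euler_identity[OF assms(2)]
  by (simp add: inner_simps)

lemma dist_null_antimono:
  assumes "J w = 0" "0 \<le> s" "s \<le> t"
  shows "norm (u t - w) \<le> norm (u s - w)"
proof -
  have "(norm (u t - w))\<^sup>2 \<le> (norm (u s - w))\<^sup>2"
  proof (rule right_derivative_nonpos_imp_le[where F="\<lambda>x. (norm (u x - w))\<^sup>2", OF assms(3)])
    have "continuous_on {s..t} u" by (rule continuous_on_subset[OF cont]) (use assms in auto)
    then show "continuous_on {s..t} (\<lambda>x. (norm (u x - w))\<^sup>2)" by (intro continuous_intros)
    show "\<exists>d\<le>0. ((\<lambda>x. (norm (u x - w))\<^sup>2) has_real_derivative d) (at_right x)"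
      if "s < x" "x < t" for x
      using dist_null_deriv[OF assms(1), of x] that assms energy_nonneg p_ge_1
      by (intro exI[of _ "- 2 * (p * energy x)"]) auto
  qed
  then show ?thesis by (rule power2_le_imp_le) simp
qed

text \<open>
  Here evenness of \<open>J\<close> enters.  The derivative of the difference of the two sides with respect to the
  earlier time is governed by \<open>\<langle>z x, u x + u t\<rangle>\<close>, which is nonnegative: test the subgradient inequality
  at \<open>- u t\<close>, whose energy is that of \<open>u t\<close> and hence at most that of \<open>u x\<close>.
\<close>

lemma dist_sq_le_norm_sq_diff:
  assumes "0 < s" "s \<le> t"
  shows "(norm (u s - u t))\<^sup>2 / 2 \<le> (norm (u s))\<^sup>2 - (norm (u t))\<^sup>2"
proof -
  let ?F = "\<lambda>x. (norm (u x - 0))\<^sup>2 - (norm (u x - u t))\<^sup>2 / 2"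
  have "?F t \<le> ?F s"
  proof (rule right_derivative_nonpos_imp_le[OF assms(2)])
    have "continuous_on {s..t} u" by (rule continuous_on_subset[OF cont]) (use assms in auto)
    then show "continuous_on {s..t} ?F" by (intro continuous_intros) auto
    fix x assume x: "s < x" "x < t"
    then have x0: "x > 0" using assms by simp
    have "- 2 * (z x \<bullet> (u x - 0)) - (- 2 * (z x \<bullet> (u x - u t))) / 2 = - (z x \<bullet> (u x + u t))"
      by (simp add: inner_simps field_simps)
    then have "(?F has_real_derivative - (z x \<bullet> (u x + u t))) (at_right x)"
      using DERIV_diff[OF dist_sq_deriv[OF x0, of 0] DERIV_cdivide[OF dist_sq_deriv[OF x0, of "u t"], of 2]]
      by (simp only:)
    moreover have "energy x + z x \<bullet> (- u t - u x) \<le> energy t"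
      using x0 x by (intro subgrad_ineq) (auto simp: J_uminus J_eq_energy)
    moreover have "energy t \<le> energy x" using x x0 by (intro energy_antimono) auto
    ultimately show "\<exists>d\<le>0. (?F has_real_derivative d) (at_right x)"
      by (intro exI[of _ "- (z x \<bullet> (u x + u t))"]) (auto simp: inner_simps)
  qed
  then show ?thesis by simp
qed

lemma converges: "\<exists>l. (u \<longlongrightarrow> l) at_top"
proof -
  define g where "g n = (norm (u (real n)))\<^sup>2" for n :: nat
  have mono: "(norm (u t))\<^sup>2 \<le> (norm (u s))\<^sup>2" if "0 < s" "s \<le> t" for s t
    using dist_null_antimono[OF J_zero, of s t] that by (simp add: power_mono)
  have "decseq (\<lambda>n. g (Suc n))" unfolding decseq_def g_def by (intro allI impI mono) auto
  then obtain m where m: "(\<lambda>n. g (Suc n)) \<longlonglongrightarrow> m" "\<And>n. m \<le> g (Suc n)"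
    using decseq_convergent[of "\<lambda>n. g (Suc n)" 0] by (auto simp: g_def)
  have close: "\<exists>n. \<forall>s\<ge>real n. \<forall>t\<ge>s. dist (u s) (u t) < e" if e: "e > 0" for e
  proof -
    have "\<forall>\<^sub>F n in sequentially. g (Suc n) < m + e\<^sup>2 / 2"
      using e by (intro order_tendstoD[OF m(1)]) auto
    then obtain n where n: "g (Suc n) < m + e\<^sup>2 / 2"
      using eventually_happens'[OF sequentially_bot] by blast
    have "dist (u s) (u t) < e" if st: "real (Suc n) \<le> s" "s \<le> t" for s t
    proof -
      have "m \<le> g (Suc (nat \<lceil>t\<rceil>))" by (rule m(2))
      also have "\<dots> \<le> (norm (u t))\<^sup>2"
        unfolding g_def using st by (intro mono) (auto, linarith)
      finally have "(norm (u s - u t))\<^sup>2 < e\<^sup>2"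
        using dist_sq_le_norm_sq_diff[of s t] mono[of "real (Suc n)" s] st n unfolding g_def by linarith
      then show ?thesis using e by (simp add: dist_norm power2_less_imp_less)
    qed
    then show ?thesis by blast
  qed
  have "Cauchy (\<lambda>n. u (real n))"
  proof (rule metric_CauchyI)
    fix e :: real assume "e > 0"
    then obtain n where n: "\<forall>s\<ge>real n. \<forall>t\<ge>s. dist (u s) (u t) < e" using close by blast
    then have "dist (u (real i)) (u (real j)) < e" if "n \<le> i" "n \<le> j" for i j
    proof (cases "i \<le> j")
      case False
      then have "dist (u (real j)) (u (real i)) < e" using n that by simp
      then show ?thesis by (simp only: dist_commute)
    qed (use n that in simp)
    then show "\<exists>M. \<forall>i\<ge>M. \<forall>j\<ge>M. dist (u (real i)) (u (real j)) < e" by blast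
  qed
  then obtain l where l: "(\<lambda>n. u (real n)) \<longlonglongrightarrow> l" by (auto simp: Cauchy_convergent_iff convergent_def)
  have "(u \<longlongrightarrow> l) at_top"
  proof (rule tendstoI)
    fix e :: real assume e: "e > 0"
    then obtain n where n: "\<forall>s\<ge>real n. \<forall>t\<ge>s. dist (u s) (u t) < e/2"
      using close[of "e/2"] by auto
    have le: "dist (u s) l \<le> e/2" if s: "s \<ge> real n" for s
    proof (rule LIMSEQ_le_const2)
      show "(\<lambda>k. dist (u s) (u (real k))) \<longlonglongrightarrow> dist (u s) l" by (intro tendsto_intros l)
      show "\<exists>M. \<forall>k\<ge>M. dist (u s) (u (real k)) \<le> e/2"
      proof (intro exI allI impI)
        fix k assume "nat \<lceil>s\<rceil> \<le> k"
        then have "s \<le> real k" by linarith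
        then show "dist (u s) (u (real k)) \<le> e/2" using n s by (simp add: less_imp_le)
      qed
    qed
    show "\<forall>\<^sub>F s in at_top. dist (u s) l < e"
      using eventually_ge_at_top[of "real n"] by eventually_elim (use e le in force)
  qed
  then show ?thesis by blast
qed

definition flow_end :: 'a where "flow_end = flow_limit u"

lemma tendsto_flow_end: "(u \<longlongrightarrow> flow_end) at_top"
  using converges tendsto_Lim[of at_top u] by (auto simp: flow_end_def flow_limit_def)

text \<open>
  An energy bounded below by \<open>c > 0\<close> would make \<open>norm (u t) ^ 2\<close> decrease at least at the rate \<open>2 c\<close>
  forever.
\<close>

lemma energy_eventually_small:
  assumes c: "c > 0"
  shows "\<forall>\<^sub>F t in at_top. energy t < c"
proof -
  have "\<exists>r\<ge>1. energy r < c"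
  proof (rule ccontr)
    assume no: "\<not> ?thesis"
    have big: "energy x \<ge> c" if "x \<ge> 1" for x using no that by force
    \<comment> \<open>By this time, decrease at rate \<open>2 c\<close> would have made \<open>norm (u t) ^ 2\<close> negative.\<close>
    define t where "t = 1 + ((norm (u 1))\<^sup>2 + 1) / c"
    have t: "1 \<le> t" using c by (simp add: t_def)
    have "(norm (u t - 0))\<^sup>2 + 2 * c * t \<le> (norm (u 1 - 0))\<^sup>2 + 2 * c * 1"
    proof (rule right_derivative_nonpos_imp_le[where F="\<lambda>x. (norm (u x - 0))\<^sup>2 + 2 * c * x", OF t])
      have "continuous_on {1..t} u" by (rule continuous_on_subset[OF cont]) auto
      then show "continuous_on {1..t} (\<lambda>x. (norm (u x - 0))\<^sup>2 + 2 * c * x)"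
        by (intro continuous_intros)
      fix x assume x: "1 < x" "x < t"
      have "((\<lambda>x. (norm (u x - 0))\<^sup>2 + 2 * c * x) has_real_derivative
         - 2 * (p * energy x) + 2 * c) (at_right x)"
        using DERIV_add[OF dist_null_deriv[OF J_zero, of x] DERIV_cmult[OF DERIV_ident, of "2 * c"]] x by simp
      moreover have "1 * c \<le> p * energy x" using p_ge_1 big[of x] x c by (intro mult_mono) auto
      ultimately show "\<exists>d\<le>0. ((\<lambda>x. (norm (u x - 0))\<^sup>2 + 2 * c * x) has_real_derivative d) (at_right x)"
        by (intro exI[of _ "- 2 * (p * energy x) + 2 * c"]) simp
    qed
    moreover have "c * t = c + ((norm (u 1 - 0))\<^sup>2 + 1)" using c by (simp add: t_def field_simps)
    moreover have "0 \<le> (norm (u t - 0))\<^sup>2" "0 \<le> (norm (u 1 - 0))\<^sup>2" by auto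
    ultimately show False by linarith
  qed
  then obtain r where r: "r \<ge> 1" "energy r < c" by blast
  show ?thesis
    using eventually_ge_at_top[of r] by eventually_elim (use energy_antimono[of r] r in force)
qed

text \<open>Lower semicontinuity carries the vanishing of the energy to the limit point.\<close>

lemma J_flow_end: "J flow_end = 0"
proof (rule ccontr)
  assume "J flow_end \<noteq> 0"
  then have "0 < J flow_end" using J_nonneg[of flow_end] by simp
  then obtain c where c: "0 < ereal c" "ereal c < J flow_end"
    by (metis ereal_dense2 less_ereal.simps(1) zero_ereal_def)
  have "ereal c < Liminf (at flow_end) J"
    using c lsc unfolding lsc_fun_def by (meson less_le_trans)
  then have "\<forall>\<^sub>F x in at flow_end. ereal c < J x" by (rule less_LiminfD)
  then have "\<forall>\<^sub>F x in nhds flow_end. ereal c < J x"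
    using c by (simp add: eventually_nhds_conv_at)
  then have "\<forall>\<^sub>F t in at_top. ereal c < J (u t)"
    using tendsto_flow_end by (rule eventually_compose_filterlim)
  moreover have "\<forall>\<^sub>F t in at_top. energy t < c" using c by (intro energy_eventually_small) simp
  moreover have "\<forall>\<^sub>F t in at_top. t > (0::real)" by (rule eventually_gt_at_top)
  ultimately have "\<forall>\<^sub>F t in at_top. (t::real) < t"
    by eventually_elim (auto simp: J_eq_energy)
  then show False by simp
qed

section \<open>Monotonicity of the Rayleigh quotient\<close>

definition gap :: "real \<Rightarrow> real" where "gap t = norm (u t - flow_end)"

lemma gap_nonneg: "0 \<le> gap t" by (simp add: gap_def)

lemma cont_gap: "continuous_on {0..} gap" unfolding gap_def by (rule cont_dist)

lemma gap_antimono: "0 \<le> s \<Longrightarrow> s \<le> t \<Longrightarrow> gap t \<le> gap s"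
  unfolding gap_def by (rule dist_null_antimono[OF J_flow_end])

lemma gap_deriv:
  assumes "t > 0" "gap t > 0"
  shows "(gap has_real_derivative - (p * energy t) / gap t) (at_right t)"
proof -
  have "((\<lambda>x. sqrt ((norm (u x - flow_end))\<^sup>2)) has_real_derivative
      inverse (sqrt ((norm (u t - flow_end))\<^sup>2)) / 2 * (- 2 * (p * energy t))) (at_right t)"
    using assms by (intro DERIV_chain2[OF DERIV_real_sqrt dist_null_deriv] J_flow_end) (auto simp: gap_def)
  then show ?thesis by (simp add: gap_def[abs_def] field_simps)
qed

lemma gap_powr_deriv:
  assumes "t > 0" "gap t > 0"
  shows "((\<lambda>x. gap x powr q) has_real_derivative - q * (p * energy t) * gap t powr (q - 2)) (at_right t)"
proof -
  have "((\<lambda>x. gap x powr q) has_real_derivative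
      q * gap t powr (q - 1) * (- (p * energy t) / gap t)) (at_right t)"
    using assms by (intro DERIV_chain2[OF has_real_derivative_powr gap_deriv])
  moreover have "gap t powr (q - 1) / gap t = gap t powr (q - 2)"
    using assms powr_diff[of "gap t" "q - 1" 1] by simp
  then have "q * gap t powr (q - 1) * (- (p * energy t) / gap t) = - q * (p * energy t) * gap t powr (q - 2)"
    by (metis (no_types, opaque_lifting) mult.assoc mult.commute mult_minus_left times_divide_eq_right)
  ultimately show ?thesis by simp
qed

definition rayleigh :: "real \<Rightarrow> real" where "rayleigh = rayleigh_quotient p J u"

lemma rayleigh_eq: "rayleigh t = p * energy t / gap t powr p"
  by (simp add: rayleigh_def rayleigh_quotient_def energy_def gap_def flow_end_def)

lemma rayleigh_nonneg: "0 \<le> rayleigh t"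
  unfolding rayleigh_eq using p_ge_1 energy_nonneg by simp

text \<open>
  Up to a positive factor, the right derivative of \<open>energy / gap powr p\<close> is
  \<open>(p * energy) ^ 2 - (norm z * gap) ^ 2\<close>, which is nonpositive by Cauchy-Schwarz.
\<close>

lemma rayleigh_antimono:
  assumes s: "0 < s" "s \<le> t" and gap_pos: "gap t > 0"
  shows "rayleigh t \<le> rayleigh s"
proof -
  have pos: "gap x > 0" if "0 < x" "x \<le> t" for x using gap_antimono[of x t] that gap_pos by simp
  let ?F = "\<lambda>x. energy x * gap x powr (- p)"
  have "?F t \<le> ?F s"
  proof (rule right_derivative_nonpos_imp_le[OF s(2)])
    have conts: "continuous_on {s..t} energy" "continuous_on {s..t} gap"
      using s continuous_on_subset[OF cont_energy[of s]] continuous_on_subset[OF cont_gap] by auto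
    have "\<forall>x\<in>{s..t}. gap x \<noteq> 0"
    proof
      fix x assume "x \<in> {s..t}"
      then show "gap x \<noteq> 0" using pos[of x] s by simp
    qed
    then show "continuous_on {s..t} ?F"
      by (intro continuous_on_mult continuous_on_powr conts continuous_on_const)
    fix x assume "s < x" "x < t"
    then have x: "0 < x" "0 < gap x" using s pos by auto
    let ?d = "(- (norm (z x))\<^sup>2) * gap x powr (- p)
      + (p * (p * energy x) * gap x powr (- p - 2)) * energy x"
    have "(?F has_real_derivative ?d) (at_right x)"
      using DERIV_mult[OF energy_deriv[OF x(1)] gap_powr_deriv[OF x, of "- p"]] by simp
    moreover have "?d \<le> 0"
    proof -
      have "p * energy x = z x \<bullet> (u x - flow_end)"
        using euler_identity null_orthogonal[OF J_flow_end] x by (simp add: inner_simps)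
      also have "\<dots> \<le> norm (z x) * gap x" unfolding gap_def by (rule norm_cauchy_schwarz)
      finally have "(p * energy x)\<^sup>2 \<le> (norm (z x) * gap x)\<^sup>2"
        using p_ge_1 energy_nonneg by (intro power_mono) auto
      then have "gap x powr (- p - 2) * (p * energy x)\<^sup>2 \<le> gap x powr (- p - 2) * (norm (z x) * gap x)\<^sup>2"
        by (intro mult_left_mono) auto
      moreover have "gap x powr (- p) = gap x powr (- p - 2) * (gap x)\<^sup>2"
        using x powr_add[of "gap x" "- p - 2" 2] by simp
      ultimately show ?thesis by (simp add: power2_eq_square mult_ac)
    qed
    ultimately show "\<exists>d\<le>0. (?F has_real_derivative d) (at_right x)" by blast
  qed
  then have "p * ?F t \<le> p * ?F s" using p_ge_1 by simp
  then show ?thesis by (simp add: rayleigh_eq powr_minus divide_inverse mult_ac)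
qed

text \<open>
  For \<open>\<delta> = 0\<close> compare with small times \<open>r > 0\<close> and let \<open>r \<rightarrow> 0\<close>: the energy at \<open>r\<close> is at most the
  initial one, and the gap is continuous at \<open>0\<close>.
\<close>

lemma rayleigh_le_admissible:
  assumes \<delta>: "0 < \<delta> \<or> \<delta> = 0 \<and> J (u 0) < \<infinity>" and t: "\<delta> < t" and gap_pos: "gap t > 0"
  shows "rayleigh t \<le> rayleigh \<delta>"
proof (cases "0 < \<delta>")
  case True
  then show ?thesis using rayleigh_antimono t gap_pos by simp
next
  case False
  then have 0: "\<delta> = 0" "J (u 0) = ereal (energy 0)" "t > 0"
    using \<delta> t not_MInf[of "u 0"] by (cases "J (u 0)"; simp add: energy_def)+
  have "gap 0 > 0" using gap_pos gap_antimono[of 0 t] 0 by simp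
  have "(gap \<longlongrightarrow> gap 0) (at_right 0)"
    using 0 by (intro continuous_on_Icc_at_rightD[of 0 t] continuous_on_subset[OF cont_gap]) auto
  then have "((\<lambda>r. p * energy 0 / gap r powr p) \<longlongrightarrow> p * energy 0 / gap 0 powr p) (at_right 0)"
    using \<open>gap 0 > 0\<close> by (intro tendsto_intros) auto
  moreover have "\<forall>\<^sub>F r in at_right 0. rayleigh t \<le> p * energy 0 / gap r powr p"
    using eventually_at_right_real[OF 0(3)]
  proof eventually_elim
    case (elim r)
    have "rayleigh t \<le> rayleigh r" using elim gap_pos by (intro rayleigh_antimono) auto
    also have "\<dots> \<le> p * energy 0 / gap r powr p"
      unfolding rayleigh_eq using elim energy_le_initial[OF 0(2), of r] p_ge_1
      by (intro divide_right_mono mult_left_mono) auto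
    finally show ?case .
  qed
  ultimately show ?thesis unfolding 0(1) rayleigh_eq[of 0] by (intro tendsto_lowerbound) auto
qed

section \<open>Lower bounds for the distance to the limit\<close>

text \<open>
  Division by \<open>2 - p\<close> gives the left-hand power the derivative \<open>- rayleigh\<close> whatever the sign
  of \<open>2 - p\<close>, so both cases \<open>p < 2\<close> and \<open>p > 2\<close> are covered at once.
\<close>

lemma powr_comparison:
  assumes \<delta>: "0 < \<delta> \<or> \<delta> = 0 \<and> J (u 0) < \<infinity>" and t: "\<delta> \<le> t" and gap_pos: "gap t > 0" and p: "p \<noteq> 2"
  shows "gap \<delta> powr (2 - p) / (2 - p) - rayleigh \<delta> * (t - \<delta>) \<le> gap t powr (2 - p) / (2 - p)"
proof -
  have pos: "gap x > 0" if "\<delta> \<le> x" "x \<le> t" for x using gap_antimono[of x t] that gap_pos \<delta> by force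
  have cancel: "- (- k * a * b / k) = a * b" if "k \<noteq> 0" for k a b :: real using that by simp
  have p': "2 - p \<noteq> 0" using p by simp
  let ?F = "\<lambda>x. - (gap x powr (2 - p) / (2 - p)) - rayleigh \<delta> * (x - \<delta>)"
  have "?F t \<le> ?F \<delta>"
  proof (rule right_derivative_nonpos_imp_le[OF t])
    have cont_g: "continuous_on {\<delta>..t} gap" by (rule continuous_on_subset[OF cont_gap]) (use \<delta> in auto)
    have "\<forall>x\<in>{\<delta>..t}. gap x \<noteq> 0" using pos by force
    then show "continuous_on {\<delta>..t} ?F"
      using p by (intro continuous_on_diff continuous_on_minus continuous_on_divide continuous_on_powr
        cont_g continuous_intros) auto
    fix x assume x: "\<delta> < x" "x < t"
    then have x0: "0 < x" "0 < gap x" using \<delta> pos by auto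
    have d: "(?F has_real_derivative
        - (- (2 - p) * (p * energy x) * gap x powr (2 - p - 2) / (2 - p)) - rayleigh \<delta>) (at_right x)"
    proof (intro DERIV_diff DERIV_minus DERIV_cdivide gap_powr_deriv x0)
      show "((\<lambda>x. rayleigh \<delta> * (x - \<delta>)) has_real_derivative rayleigh \<delta>) (at_right x)"
        by (auto intro!: derivative_eq_intros)
    qed
    have eq: "- (- (2 - p) * (p * energy x) * gap x powr (2 - p - 2) / (2 - p)) = rayleigh x"
      unfolding cancel[OF p'] by (simp add: rayleigh_eq powr_minus divide_inverse)
    show "\<exists>d\<le>0. (?F has_real_derivative d) (at_right x)"
      using d[unfolded eq] rayleigh_le_admissible[OF \<delta> x(1) x0(2)]
      by (intro exI[of _ "rayleigh x - rayleigh \<delta>"]) simp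
  qed
  then show ?thesis by simp
qed

text \<open>The logarithm takes the place of the power as the primitive of \<open>gap powr (1 - p)\<close> at \<open>p = 2\<close>.\<close>

lemma ln_comparison:
  assumes \<delta>: "0 < \<delta> \<or> \<delta> = 0 \<and> J (u 0) < \<infinity>" and t: "\<delta> \<le> t" and gap_pos: "gap t > 0" and p: "p = 2"
  shows "ln (gap \<delta>) - rayleigh \<delta> * (t - \<delta>) \<le> ln (gap t)"
proof -
  have pos: "gap x > 0" if "\<delta> \<le> x" "x \<le> t" for x using gap_antimono[of x t] that gap_pos \<delta> by force
  let ?F = "\<lambda>x. - ln (gap x) - rayleigh \<delta> * (x - \<delta>)"
  have "?F t \<le> ?F \<delta>"
  proof (rule right_derivative_nonpos_imp_le[OF t])
    have cont_g: "continuous_on {\<delta>..t} gap" by (rule continuous_on_subset[OF cont_gap]) (use \<delta> in auto)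
    have "\<forall>x\<in>{\<delta>..t}. gap x \<noteq> 0" using pos by force
    then show "continuous_on {\<delta>..t} ?F"
      by (intro continuous_on_diff continuous_on_minus continuous_on_ln cont_g continuous_intros)
    fix x assume x: "\<delta> < x" "x < t"
    then have x0: "0 < x" "0 < gap x" using \<delta> pos by auto
    have d: "(?F has_real_derivative - (1 / gap x * (- (p * energy x) / gap x)) - rayleigh \<delta>) (at_right x)"
      by (rule derivative_eq_intros gap_deriv x0 refl | simp)+
    have eq: "- (1 / gap x * (- (p * energy x) / gap x)) = rayleigh x"
    proof -
      have "gap x powr 2 = gap x * gap x" using x0 by (simp add: power2_eq_square)
      then show ?thesis unfolding rayleigh_eq using p by simp
    qed
    show "\<exists>d\<le>0. (?F has_real_derivative d) (at_right x)"
      using d[unfolded eq] rayleigh_le_admissible[OF \<delta> x(1) x0(2)]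
      by (intro exI[of _ "rayleigh x - rayleigh \<delta>"]) simp
  qed
  then show ?thesis by simp
qed

text \<open>
  If the flow is extinct at \<open>t\<close>, the comparison lemmas, which need a positive gap, are applied at
  earlier times with arbitrarily small gap.
\<close>

lemma near_extinction:
  assumes "0 \<le> \<delta>" "\<delta> \<le> t" "gap \<delta> > 0" "gap t = 0" and e: "e > 0"
  obtains x where "\<delta> \<le> x" "x \<le> t" "0 < gap x" "gap x < e"
proof -
  have cont: "continuous_on {\<delta>..t} gap" by (rule continuous_on_subset[OF cont_gap]) (use assms in auto)
  obtain x where x: "\<delta> \<le> x" "x \<le> t" "gap x = min (gap \<delta>) e / 2"
  proof -
    have "min (gap \<delta>) e / 2 \<le> gap \<delta>" using assms by linarith
    then show ?thesis using IVT2'[of gap t "min (gap \<delta>) e / 2" \<delta>] assms cont that by auto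
  qed
  show ?thesis by (rule that[OF x(1,2)]) (use x(3) assms in auto)
qed

lemma lower_bounds:
  assumes \<delta>: "0 < \<delta> \<or> \<delta> = 0 \<and> J (u 0) < \<infinity>" and t: "\<delta> \<le> t" and gap_pos: "gap \<delta> > 0"
  shows "p < 2 \<Longrightarrow> gap \<delta> powr (2 - p) - (2 - p) * rayleigh \<delta> * (t - \<delta>) \<le> gap t powr (2 - p)"
    and "p = 2 \<Longrightarrow> (gap \<delta>)\<^sup>2 * exp (- 2 * rayleigh \<delta> * (t - \<delta>)) \<le> (gap t)\<^sup>2"
    and "p > 2 \<Longrightarrow> 1 / (gap \<delta> powr (2 - p) + (p - 2) * rayleigh \<delta> * (t - \<delta>)) \<le> gap t powr (p - 2)"
proof -
  have \<delta>0: "0 \<le> \<delta>" using \<delta> by auto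
  have rayleigh_mono: "rayleigh \<delta> * (x - \<delta>) \<le> rayleigh \<delta> * (t - \<delta>)" if "x \<le> t" for x
    using that rayleigh_nonneg by (intro mult_left_mono) auto
  have cancel: "(a / (2 - p) - b) * (2 - p) = a - (2 - p) * b" "a / (2 - p) * (2 - p) = a"
    if "p \<noteq> 2" for a b
    using that by (simp_all add: left_diff_distrib mult.commute[of b])
  note near = near_extinction[OF \<delta>0 t gap_pos]
  {
    assume p: "p < 2"
    have main: "gap \<delta> powr (2 - p) \<le> gap x powr (2 - p) + (2 - p) * rayleigh \<delta> * (t - \<delta>)"
      if "\<delta> \<le> x" "x \<le> t" "0 < gap x" for x
    proof -
      have "gap \<delta> powr (2 - p) / (2 - p) - rayleigh \<delta> * (t - \<delta>) \<le> gap x powr (2 - p) / (2 - p)"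
        using powr_comparison[OF \<delta> that(1,3)] p rayleigh_mono[OF that(2)] by linarith
      then have "(gap \<delta> powr (2 - p) / (2 - p) - rayleigh \<delta> * (t - \<delta>)) * (2 - p)
          \<le> gap x powr (2 - p) / (2 - p) * (2 - p)"
        using p by (intro mult_right_mono) auto
      then have "gap \<delta> powr (2 - p) - (2 - p) * (rayleigh \<delta> * (t - \<delta>)) \<le> gap x powr (2 - p)"
        using p by (simp only: cancel)
      then show ?thesis by (simp add: mult.assoc)
    qed
    show "gap \<delta> powr (2 - p) - (2 - p) * rayleigh \<delta> * (t - \<delta>) \<le> gap t powr (2 - p)"
    proof (cases "gap t > 0")
      case True
      then show ?thesis using main[of t] t by simp
    next
      case False
      then have gap_t: "gap t = 0" using gap_nonneg[of t] by simp
      have "gap \<delta> powr (2 - p) \<le> (2 - p) * rayleigh \<delta> * (t - \<delta>) + e" if e: "e > 0" for e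
      proof -
        obtain x where x: "\<delta> \<le> x" "x \<le> t" "0 < gap x" "gap x < e powr (1 / (2 - p))"
          using near[OF gap_t, of "e powr (1 / (2 - p))"] e by auto
        have "gap x powr (2 - p) \<le> (e powr (1 / (2 - p))) powr (2 - p)"
          using x p by (intro powr_mono2) auto
        also have "\<dots> = e" using p e by (simp add: powr_powr)
        finally show ?thesis using main[OF x(1-3)] by simp
      qed
      then have "gap \<delta> powr (2 - p) \<le> (2 - p) * rayleigh \<delta> * (t - \<delta>)" by (rule field_le_epsilon)
      then show ?thesis using gap_t by simp
    qed
  next
    assume p: "p = 2"
    have main: "gap \<delta> * exp (- rayleigh \<delta> * (t - \<delta>)) \<le> gap x" if "\<delta> \<le> x" "x \<le> t" "0 < gap x" for x
    proof -
      have "ln (gap \<delta>) - rayleigh \<delta> * (t - \<delta>) \<le> ln (gap x)"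
        using ln_comparison[OF \<delta> that(1,3) p] rayleigh_mono[OF that(2)] by linarith
      then have "exp (ln (gap \<delta>) - rayleigh \<delta> * (t - \<delta>)) \<le> exp (ln (gap x))" by simp
      then show ?thesis using gap_pos that by (simp add: exp_diff exp_minus divide_inverse)
    qed
    \<comment> \<open>The bound before extinction is uniform in time and positive, so extinction cannot occur.\<close>
    have "gap t > 0"
    proof (rule ccontr)
      assume "\<not> gap t > 0"
      then have "gap t = 0" using gap_nonneg[of t] by simp
      from near[OF this, of "gap \<delta> * exp (- rayleigh \<delta> * (t - \<delta>))"] obtain x
        where "\<delta> \<le> x" "x \<le> t" "0 < gap x" "gap x < gap \<delta> * exp (- rayleigh \<delta> * (t - \<delta>))" using gap_pos by auto
      then show False using main[of x] by simp
    qed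
    then have "(gap \<delta> * exp (- rayleigh \<delta> * (t - \<delta>)))\<^sup>2 \<le> (gap t)\<^sup>2"
      using main[of t] t gap_pos by (intro power_mono) auto
    then show "(gap \<delta>)\<^sup>2 * exp (- 2 * rayleigh \<delta> * (t - \<delta>)) \<le> (gap t)\<^sup>2"
      by (simp add: power_mult_distrib mult.assoc flip: exp_double)
  next
    assume p: "p > 2"
    define A where "A = gap \<delta> powr (2 - p) + (p - 2) * rayleigh \<delta> * (t - \<delta>)"
    have A: "A > 0" unfolding A_def using gap_pos p t rayleigh_nonneg by (intro add_pos_nonneg) auto
    have main: "gap x powr (2 - p) \<le> A" if "\<delta> \<le> x" "x \<le> t" "0 < gap x" for x
    proof -
      have "gap \<delta> powr (2 - p) / (2 - p) - rayleigh \<delta> * (t - \<delta>) \<le> gap x powr (2 - p) / (2 - p)"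
        using powr_comparison[OF \<delta> that(1,3)] p rayleigh_mono[OF that(2)] by linarith
      then have "gap x powr (2 - p) / (2 - p) * (2 - p)
          \<le> (gap \<delta> powr (2 - p) / (2 - p) - rayleigh \<delta> * (t - \<delta>)) * (2 - p)"
        using p by (intro mult_right_mono_neg) auto
      then have "gap x powr (2 - p) \<le> gap \<delta> powr (2 - p) - (2 - p) * (rayleigh \<delta> * (t - \<delta>))"
        using p by (simp only: cancel)
      then show ?thesis by (simp add: A_def algebra_simps)
    qed
    \<comment> \<open>As \<open>2 - p < 0\<close>, the upper bound \<open>A\<close> keeps the gap away from zero.\<close>
    have gap_t: "gap t > 0"
    proof (rule ccontr)
      assume "\<not> gap t > 0"
      then have "gap t = 0" using gap_nonneg[of t] by simp
      from near[OF this, of "A powr (1 / (2 - p))"] obtain x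
        where x: "\<delta> \<le> x" "x \<le> t" "0 < gap x" "gap x < A powr (1 / (2 - p))" using A by auto
      have "(A powr (1 / (2 - p))) powr (2 - p) < gap x powr (2 - p)"
        using x p by (intro powr_less_mono2_neg) auto
      moreover have "(A powr (1 / (2 - p))) powr (2 - p) = A" using p A by (simp add: powr_powr)
      ultimately show False using main[OF x(1-3)] by simp
    qed
    have "1 / A \<le> 1 / gap t powr (2 - p)" using main[of t] t gap_t A by (intro divide_left_mono) auto
    also have "\<dots> = gap t powr (p - 2)" using powr_minus_divide[of "gap t" "2 - p"] by simp
    finally show "1 / (gap \<delta> powr (2 - p) + (p - 2) * rayleigh \<delta> * (t - \<delta>)) \<le> gap t powr (p - 2)"
      by (simp add: A_def)
  }
qed

text \<open>
  For \<open>\<delta> = 0\<close> the definition of the extinction time says nothing about \<open>u 0\<close>; positivity is inherited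
  from a later time because the gap decreases.
\<close>

lemma gap_pos_before_extinction:
  assumes "0 \<le> \<delta>" "ereal \<delta> < extinction_time u" "0 < extinction_time u"
  shows "gap \<delta> > 0"
proof -
  obtain r where r: "ereal \<delta> < ereal r" "ereal r < extinction_time u"
    using ereal_dense2[OF assms(2)] by blast
  have "u r \<noteq> flow_limit u"
  proof
    assume "u r = flow_limit u"
    then have "extinction_time u \<le> ereal r"
      unfolding extinction_time_def using r assms by (intro Inf_lower) auto
    then show False using r by simp
  qed
  then have "gap r > 0" by (simp add: gap_def flow_end_def)
  then show ?thesis using gap_antimono[of \<delta> r] r assms by simp
qed

end

theorem proposition2p67:
  fixes J :: "'a::{real_inner, complete_space} \<Rightarrow> ereal"
    and p :: real and f :: 'a and u :: "real \<Rightarrow> 'a"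
  assumes "p \<ge> 1"
    and "abs_homogeneous p J" and "proper_fun J" and "convex_fun J" and "lsc_fun J"
    and "f \<in> closure (effective_domain J)"
    and "gradient_flow J f u"
    and "extinction_time u > 0"
  defines "u_inf \<equiv> flow_limit u"
    and "\<Lambda> \<equiv> rayleigh_quotient p J u"
  shows "\<forall>\<delta> t. (0 < \<delta> \<or> \<delta> = 0 \<and> J f < \<infinity>) \<and> ereal \<delta> < extinction_time u \<and> \<delta> \<le> t \<longrightarrow>
    (p < 2 \<longrightarrow>
       norm (u t - u_inf) powr (2 - p)
         \<ge> norm (u \<delta> - u_inf) powr (2 - p) - (2 - p) * \<Lambda> \<delta> * (t - \<delta>)) \<and>
    (p = 2 \<longrightarrow>
       (norm (u t - u_inf))\<^sup>2
         \<ge> (norm (u \<delta> - u_inf))\<^sup>2 * exp (- 2 * \<Lambda> \<delta> * (t - \<delta>))) \<and>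
    (p > 2 \<longrightarrow>
       norm (u t - u_inf) powr (p - 2)
         \<ge> 1 / (norm (u \<delta> - u_inf) powr (2 - p) + (p - 2) * \<Lambda> \<delta> * (t - \<delta>)))"
proof -
  have flow: "continuous_on {0..} u" "u 0 = f"
    "\<forall>t. \<exists>\<zeta>. t > 0 \<longrightarrow> is_arg_min norm (\<lambda>\<eta>. \<eta> \<in> subdifferential J (u t)) \<zeta> \<and>
              (u has_vector_derivative - \<zeta>) (at_right t)"
    using assms(7) by (auto simp: gradient_flow_def)
  from choice[OF flow(3)] obtain z where z: "\<And>t. t > 0 \<Longrightarrow>
      is_arg_min norm (\<lambda>\<eta>. \<eta> \<in> subdifferential J (u t)) (z t) \<and>
      (u has_vector_derivative - z t) (at_right t)" by blast
  interpret homogeneous_flow J u z p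
    by unfold_locales (use assms flow z in \<open>auto simp: is_arg_min_linorder\<close>)
  have limit: "u_inf = flow_end" unfolding u_inf_def flow_end_def ..
  have quotient: "\<Lambda> = rayleigh" unfolding \<Lambda>_def rayleigh_def ..
  show ?thesis
  proof (intro allI impI, elim conjE)
    fix \<delta> t assume adm: "0 < \<delta> \<or> \<delta> = 0 \<and> J f < \<infinity>" and ext: "ereal \<delta> < extinction_time u"
      and t: "\<delta> \<le> t"
    then have adm': "0 < \<delta> \<or> \<delta> = 0 \<and> J (u 0) < \<infinity>" using flow by simp
    have "gap \<delta> > 0" using adm ext assms(8) by (intro gap_pos_before_extinction) auto
    from lower_bounds[OF adm' t this]
    show "(p < 2 \<longrightarrow>
       norm (u t - u_inf) powr (2 - p)
         \<ge> norm (u \<delta> - u_inf) powr (2 - p) - (2 - p) * \<Lambda> \<delta> * (t - \<delta>)) \<and>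
    (p = 2 \<longrightarrow>
       (norm (u t - u_inf))\<^sup>2
         \<ge> (norm (u \<delta> - u_inf))\<^sup>2 * exp (- 2 * \<Lambda> \<delta> * (t - \<delta>))) \<and>
    (p > 2 \<longrightarrow>
       norm (u t - u_inf) powr (p - 2)
         \<ge> 1 / (norm (u \<delta> - u_inf) powr (2 - p) + (p - 2) * \<Lambda> \<delta> * (t - \<delta>)))"
      unfolding limit quotient gap_def by blast
  qed
qed

end
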